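(* Let $\boldsymbol{f}_{i,S}$, $i=1,\dots,d$, be entropy conservative fluxes (symmetric, consistent, and satisfying $(\boldsymbol v_L-\boldsymbol v_R)^T\boldsymbol f_{i,S}(\boldsymbol u_L,\boldsymbol u_R)=\psi_i(\boldsymbol u_L)-\psi_i(\boldsymbol u_R)$), and assume that $\boldsymbol Q^j_k\boldsymbol 1=0$ for $j=1,\dots,d$ on each element $D^k$. Let the coefficient vectors $\boldsymbol u_h(t)$ (one per element) solve the weight-adjusted semi-discrete scheme: on each element $D^k$, $$\frac{d\boldsymbol u_h}{dt}+\boldsymbol M^{-1}\boldsymbol M_{1/J^k}\boldsymbol M^{-1}\begin{bmatrix}\boldsymbol V_q^T\boldsymbol W & \boldsymbol V_f^T\boldsymbol W_f\end{bmatrix}\sum_{j=1}^d\left(2\boldsymbol D^j_k\circ\boldsymbol F_{j,S}\right)\boldsymbol 1+\sum_{j=1}^d\tilde{\boldsymbol L}^k_q\,\mathrm{diag}(\boldsymbol n_j)\left(\boldsymbol f_j^*-\boldsymbol f_j(\tilde{\boldsymbol u}_f)\right)=0,$$ where $(\boldsymbol F_{j,S})_{mn}=\boldsymbol f_{j,S}(\tilde{\boldsymbol u}_m,\tilde{\boldsymbol u}_n)$ for $1\le m,n\le N_q+N_q^f$, $\boldsymbol f_j^*=\boldsymbol f_{j,S}(\tilde{\boldsymbol u}_f^+,\tilde{\boldsymbol u}_f)$ on interior faces, and on faces in $\partial\Omega$ $\boldsymbol f_j^*$ is the $j$th component of some numerical flux through which boundary conditions are imposed. Here $\boldsymbol u_q=\boldsymbol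 V_q\boldsymbol u_h$, $\boldsymbol v_h=\tilde{\boldsymbol P}^k_q\boldsymbol v(\boldsymbol u_q)$ (the weight-adjusted projection of the entropy variables), $\tilde{\boldsymbol v}=\begin{bmatrix}\tilde{\boldsymbol v}_q\\ \tilde{\boldsymbol v}_f\end{bmatrix}=\begin{bmatrix}\boldsymbol V_q\\ \boldsymbol V_f\end{bmatrix}\boldsymbol v_h$, and $\tilde{\boldsymbol u}=\begin{bmatrix}\tilde{\boldsymbol u}_q\\ \tilde{\boldsymbol u}_f\end{bmatrix}=\boldsymbol u(\tilde{\boldsymbol v})$. Then the scheme is entropy conservative in the sense that $$\sum_k\boldsymbol 1^T\mathrm{diag}(\boldsymbol J^k)\boldsymbol W\frac{dU(\boldsymbol u_q)}{dt}=\sum_k\sum_{j=1}^d\boldsymbol 1^T\mathrm{diag}(\boldsymbol n_j\circ\boldsymbol J^k_f)\boldsymbol W_{\partial\Omega}\left(\psi_j(\tilde{\boldsymbol u}_f)-\tilde{\boldsymbol v}_f^T\boldsymbol f_j^*\right).$$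
   Context: Conservation law: $\partial_t\boldsymbol u+\sum_{j=1}^d\partial_{x_j}\boldsymbol f_j(\boldsymbol u)=0$ with $\boldsymbol u(\boldsymbol x,t)\in\mathbb R^n$ and $\boldsymbol f_j:\mathbb R^n\to\mathbb R^n$. There is a convex entropy $U(\boldsymbol u)$ with entropy variables $\boldsymbol v(\boldsymbol u)=\partial U/\partial\boldsymbol u$ (an invertible change of variables with inverse $\boldsymbol u(\boldsymbol v)$), entropy fluxes $F_j$ with $\boldsymbol v^T\partial\boldsymbol f_j/\partial\boldsymbol u=(\partial F_j/\partial\boldsymbol u)^T$, and entropy potentials $\psi_j(\boldsymbol v)=\boldsymbol v^T\boldsymbol f_j(\boldsymbol u(\boldsymbol v))-F_j(\boldsymbol u(\boldsymbol v))$; $\psi_j(\boldsymbol u)$ means $\psi_j(\boldsymbol v(\boldsymbol u))$. All states are assumed to lie where these maps are defined and smooth. Entropy conservative flux: a bivariate function $\boldsymbol f_{i,S}(\boldsymbol u_L,\boldsymbol u_R)$ with (1) $\boldsymbol f_{i,S}(\boldsymbol u_L,\boldsymbol u_R)=\boldsymbol f_{i,S}(\boldsymbol u_R,\boldsymbol u_L)$; (2) $\boldsymbol f_{i,S}(\boldsymbol u,\boldsymbol u)=\boldsymbol f_i(\boldsymbol u)$; (3) $(\boldsymbol v_L-\boldsymbol v_R)^T\boldsymbol f_{i,S}(\boldsymbol u_L,\boldsymbol u_R)=\psi_i(\boldsymbol u_L)-\psi_i(\boldsymbol u_R)$, where $\boldsymbol v_L=\boldsymbol v(\boldsymbol u_L)$,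 $\boldsymbol v_R=\boldsymbol v(\boldsymbol u_R)$. Reference element: $\hat D\subset\mathbb R^d$ has planar faces with constant unit outward normals with components $\hat n_i$; $P^N(\hat D)$ is the degree $N$ polynomial approximation space with basis $\phi_1,\dots,\phi_{N_p}$. Volume quadrature: points and positive weights $(\hat{\boldsymbol x}_i,\hat w_i)_{i=1}^{N_q}$; surface quadrature: $(\hat{\boldsymbol x}^f_i,\hat w^f_i)_{i=1}^{N_q^f}$ on $\partial\hat D$, with weights given by quadrature on reference faces, and $\hat{\boldsymbol J}_f$ the vector of Jacobian factors from mapping a face of $\hat D$ to the reference face. Assumption on quadrature: the volume rule is exact for polynomials of degree $2N-1$, and for all $u,v\in P^N(\hat D)$ integration by parts $(\partial u/\partial\hat x_i,v)_{\hat D}=\langle u,v\hat n_i\rangle_{\partial\hat D}-(u,\partial v/\partial\hat x_i)_{\hat D}$ holds when the volume and surface integrals are evaluated with quadrature. $\boldsymbol W,\boldsymbol W_f$ are the diagonal matrices of volume and surface weights. $(\boldsymbol V_q)_{ij}=\phi_j(\hat{\boldsymbol x}_i)$, $(\boldsymbol V_f)_{ij}=\phi_j(\hat{\boldsymbol x}^f_i)$. $\boldsymbol D_i$ maps basis coefficients of $u\in P^N(\hat D)$ to basis coefficients of $\partial u/\partial\hat x_i$. $\boldsymbol M=\boldsymbol V_q^T\boldsymbol W\boldsymbol V_q$ (assumed positive definite), $\boldsymbol P_q=\boldsymbol M^{-1}\boldsymbol V_q^T\boldsymbol W$, $\boldsymbol L_q=\boldsymbol M^{-1}\boldsymbol V_f^T\boldsymbol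 W_f$. With $\hat{\boldsymbol n}_i$ the vector of values of $\hat n_i$ at surface points and $\circ$ the Hadamard (entrywise) product, $$\boldsymbol D_N^i=\begin{bmatrix}\boldsymbol V_q\boldsymbol D_i\boldsymbol P_q-\tfrac12\boldsymbol V_q\boldsymbol L_q\,\mathrm{diag}(\hat{\boldsymbol n}_i\circ\hat{\boldsymbol J}_f)\boldsymbol V_f\boldsymbol P_q&\tfrac12\boldsymbol V_q\boldsymbol L_q\,\mathrm{diag}(\hat{\boldsymbol n}_i\circ\hat{\boldsymbol J}_f)\\-\tfrac12\mathrm{diag}(\hat{\boldsymbol n}_i\circ\hat{\boldsymbol J}_f)\boldsymbol V_f\boldsymbol P_q&\tfrac12\mathrm{diag}(\hat{\boldsymbol n}_i\circ\hat{\boldsymbol J}_f)\end{bmatrix},\qquad\boldsymbol W_N=\begin{pmatrix}\boldsymbol W&\\&\boldsymbol W_f\end{pmatrix}.$$ Physical elements: $\Omega\subset\mathbb R^d$ is decomposed into elements $D^k=\boldsymbol\Phi_k(\hat D)$, with $\boldsymbol\Phi_k$ smooth and invertible with Jacobian determinant $J^k>0$. $G^k_{ij}$ denotes $J^k\,\partial\hat x_j/\partial x_i$ (or an approximation of it) and $\boldsymbol G^k_{ij}$ its vector of values at all volume and surface quadrature points, $(\boldsymbol G^k_{ij})_f$ its surface part. $\boldsymbol J^k$ is the vector of values of $J^k$ at volume points; $\boldsymbol n_i$ and $\boldsymbol J^k_f$ are the vectors of values at surface points of the $i$th component of the outward unit normal and of the face Jacobian factor of $D^k$. Mesh assumptions: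 the mesh is quasi-uniform and watertight; on a face shared by $D^k$ and $D^{k,+}$ the surface quadrature points and weights match and $\boldsymbol nJ^k_f=-\boldsymbol n^+J^{k,+}_f$ at all points; and $\sum_{j=1}^d(\boldsymbol G^k_{ij})_f\circ(\hat{\boldsymbol n}_j\circ\hat{\boldsymbol J}_f)=\boldsymbol n_i\circ\boldsymbol J^k_f$. Define $$\boldsymbol D^i_k=\tfrac12\sum_{j=1}^d\left(\mathrm{diag}(\boldsymbol G^k_{ij})\boldsymbol D^j_N+\boldsymbol D^j_N\mathrm{diag}(\boldsymbol G^k_{ij})\right),\quad\boldsymbol Q^i_k=\boldsymbol W_N\boldsymbol D^i_k,\quad\boldsymbol M_{1/J^k}=\boldsymbol V_q^T\boldsymbol W\,\mathrm{diag}(1/\boldsymbol J^k)\boldsymbol V_q,$$ $$\tilde{\boldsymbol P}^k_q=\boldsymbol M^{-1}\boldsymbol M_{1/J^k}\boldsymbol M^{-1}\boldsymbol V_q^T\boldsymbol W\,\mathrm{diag}(\boldsymbol J^k),\qquad\tilde{\boldsymbol L}^k_q=\boldsymbol M^{-1}\boldsymbol M_{1/J^k}\boldsymbol M^{-1}\boldsymbol V_f^T\boldsymbol W_f\,\mathrm{diag}(\boldsymbol J^k_f).$$ Conventions: $\boldsymbol 1$ is the vector of all ones. The coefficients $(\boldsymbol u_h)_j\in\mathbb R^n$ are vector-valued and all matrices act componentwise (Kronecker sense); nonlinear functions ($\boldsymbol v(\cdot)$, $\boldsymbol u(\cdot)$, $U$, $\psi_j$, $\boldsymbol f_j$) act pointwise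 at quadrature points, and $\tilde{\boldsymbol v}_f^T\boldsymbol f_j^*$ is the vector of pointwise inner products in $\mathbb R^n$. $\tilde{\boldsymbol u}_f^+$ denotes the values of $\tilde{\boldsymbol u}_f$ on the neighboring element across each face. $\boldsymbol W_{\partial\Omega}$ is the diagonal matrix with $(\boldsymbol W_{\partial\Omega})_{ii}=(\boldsymbol W_f)_{ii}$ if the $i$th surface point of the element lies on $\partial\Omega$, and $0$ otherwise. *)

theory Defs
  imports "HOL-Analysis.Analysis"
begin

text \<open>
  Conventions.  Vectors and matrices are indexed by finite types: \<open>'d\<close> (space dimensions),
  \<open>'n\<close> (components of a state), \<open>'p\<close> (basis functions), \<open>'q\<close> and \<open>'s\<close> (volume and surface
  quadrature points of one element), \<open>'g\<close> (faces of the reference element), \<open>'k\<close> (elements of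
  the mesh).  A vector over all volume and surface points is indexed by \<open>'q + 's\<close>.

  A vector of states, one for each \<open>j :: 'p\<close>, has type \<open>real^'n^'p\<close>; a matrix
  \<open>A :: real^'p^'q\<close> acts on it componentwise (Kronecker sense) by the product \<open>A ** X\<close>.

  On \<open>real^'i\<close>, the library product \<open>x * y\<close> is the entrywise (Hadamard) product and
  \<open>1\<close> is the vector of all ones.
\<close>

section \<open>Matrices and pointwise operations\<close>

definition diag :: "real^'i \<Rightarrow> real^'i^'i" where
  "diag x = (\<chi> i j. if i = j then x $ i else 0)"

definition pointwise :: "('a \<Rightarrow> 'b) \<Rightarrow> 'a^'i \<Rightarrow> 'b^'i" where
  "pointwise g X = (\<chi> i. g (X $ i))"

definition surf_part :: "'a^('q::finite + 's::finite) \<Rightarrow> 'a^'s" where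
  "surf_part X = (\<chi> i. X $ Inr i)"

definition vcat :: "'a^'q \<Rightarrow> 'a^'s \<Rightarrow> 'a^('q::finite + 's::finite)" where
  "vcat X Y = (\<chi> m. case m of Inl i \<Rightarrow> X $ i | Inr i \<Rightarrow> Y $ i)"

definition hcat :: "real^'q^'p \<Rightarrow> real^'s^'p \<Rightarrow> real^('q::finite + 's::finite)^'p" where
  "hcat A B = (\<chi> i. vcat (A $ i) (B $ i))"

definition block_matrix ::
  "real^'q::finite^'q \<Rightarrow> real^'s^'q \<Rightarrow> real^'q^'s \<Rightarrow> real^'s^'s \<Rightarrow> real^('q + 's)^('q + 's)" where
  "block_matrix A B C D = vcat (hcat A B) (hcat C D)"

text \<open>\<open>(A \<circ> F) 1\<close> for a scalar matrix \<open>A\<close> and a matrix \<open>F\<close> of states.\<close>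

definition hadamard_ones :: "real^'m^'m \<Rightarrow> (real^'n)^'m^'m \<Rightarrow> real^'n^'m" where
  "hadamard_ones A F = (\<chi> i. \<Sum>j\<in>UNIV. A $ i $ j *\<^sub>R F $ i $ j)"

text \<open>
  For an invertible \<open>A\<close> and a unit vector \<open>\<nu>\<close>, the linear map \<open>A\<close> restricted to the hyperplane
  orthogonal to \<open>\<nu>\<close> multiplies \<open>(d - 1)\<close>-dimensional area by \<open>\<bar>cof(A) \<nu>\<bar>\<close> and sends it to the
  hyperplane with normal \<open>cof(A) \<nu>\<close>, where \<open>cof(A)\<close> is \<open>det A\<close> times the inverse transpose of \<open>A\<close>
  (Nanson's formula).
\<close>

definition area_factor :: "real^'d^'d \<Rightarrow> real^'d \<Rightarrow> real" where
  "area_factor A \<nu> = norm (det A *\<^sub>R (transpose (matrix_inv A) *v \<nu>))"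

section \<open>Smooth functions and polynomials\<close>

primrec Ck_on :: "nat \<Rightarrow> ('a::real_normed_vector \<Rightarrow> 'b::real_normed_vector) \<Rightarrow> 'a set \<Rightarrow> bool" where
  "Ck_on 0 f S \<longleftrightarrow> continuous_on S f"
| "Ck_on (Suc k) f S \<longleftrightarrow>
     (\<forall>x\<in>S. f differentiable (at x)) \<and> (\<forall>h. Ck_on k (\<lambda>x. frechet_derivative f (at x) h) S)"

definition smooth_on :: "('a::euclidean_space \<Rightarrow> 'b::euclidean_space) \<Rightarrow> 'a set \<Rightarrow> bool" where
  "smooth_on f S \<longleftrightarrow> open S \<and> (\<forall>k. Ck_on k f S)"

definition partial :: "'d \<Rightarrow> (real^'d \<Rightarrow> real) \<Rightarrow> real^'d \<Rightarrow> real" where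
  "partial i p x = frechet_derivative p (at x) (axis i 1)"

text \<open>Polynomial functions of total degree at most \<open>m\<close>; \<open>\<alpha>\<close> ranges over multi-indices.\<close>

definition poly_space :: "nat \<Rightarrow> (real^'d \<Rightarrow> real) set" where
  "poly_space m = {p. \<exists>c. p = (\<lambda>x. \<Sum>\<alpha> | (\<Sum>i\<in>UNIV. \<alpha> i) \<le> m. c \<alpha> * (\<Prod>i\<in>UNIV. (x $ i) ^ \<alpha> i))}"

section \<open>The reference element\<close>

text \<open>
  \<open>(d - 1)\<close>-dimensional space, which contains the reference faces \<open>ref_face R g\<close>, is the coordinate
  hyperplane \<open>{y. y $ face_coord R = 0}\<close> (this includes \<open>d = 1\<close>).  The face \<open>face R g\<close> is the
  image of its reference face under the affine map with linear part \<open>face_lin R g\<close> and offset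
  \<open>face_indexf R g\<close>.  The surface point with index \<open>s\<close> belongs to the face \<open>face_index R s\<close>.
\<close>

record ('d, 'p, 'q, 's, 'g) ref_element =
  Dhat :: "(real^'d) set"
  face_normal :: "'g \<Rightarrow> real^'d"
  face_coord :: 'd
  ref_face :: "'g \<Rightarrow> (real^'d) set"
  face_lin :: "'g \<Rightarrow> real^'d^'d"
  face_indexf :: "'g \<Rightarrow> real^'d"
  deg :: nat
  basis :: "'p \<Rightarrow> real^'d \<Rightarrow> real"
  diff_matrix :: "'d \<Rightarrow> real^'p^'p"
  vol_point :: "'q \<Rightarrow> real^'d"
  vol_weight :: "real^'q"
  surf_point :: "'s \<Rightarrow> real^'d"
  surf_weight :: "real^'s"
  face_index :: "'s \<Rightarrow> 'g"

definition face :: "('d::finite, 'p::finite, 'q::finite, 's::finite, 'g::finite) ref_element \<Rightarrow> 'g \<Rightarrow> (real^'d) set" where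
  "face R g = (\<lambda>y. face_indexf R g + face_lin R g *v y) ` ref_face R g"

definition expand :: "('d::finite, 'p::finite, 'q::finite, 's::finite, 'g::finite) ref_element \<Rightarrow> real^'p \<Rightarrow> real^'d \<Rightarrow> real" where
  "expand R c x = (\<Sum>j\<in>UNIV. c $ j * basis R j x)"

definition Wq :: "('d::finite, 'p::finite, 'q::finite, 's::finite, 'g::finite) ref_element \<Rightarrow> real^'q^'q" where
  "Wq R = diag (vol_weight R)"

definition Wf :: "('d::finite, 'p::finite, 'q::finite, 's::finite, 'g::finite) ref_element \<Rightarrow> real^'s^'s" where
  "Wf R = diag (surf_weight R)"

definition Vq :: "('d::finite, 'p::finite, 'q::finite, 's::finite, 'g::finite) ref_element \<Rightarrow> real^'p^'q" where
  "Vq R = (\<chi> i j. basis R j (vol_point R i))"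

definition Vf :: "('d::finite, 'p::finite, 'q::finite, 's::finite, 'g::finite) ref_element \<Rightarrow> real^'p^'s" where
  "Vf R = (\<chi> i j. basis R j (surf_point R i))"

definition nhat :: "('d::finite, 'p::finite, 'q::finite, 's::finite, 'g::finite) ref_element \<Rightarrow> 'd \<Rightarrow> real^'s" where
  "nhat R i = (\<chi> s. face_normal R (face_index R s) $ i)"

definition Jhat :: "('d::finite, 'p::finite, 'q::finite, 's::finite, 'g::finite) ref_element \<Rightarrow> real^'s" where
  "Jhat R = (\<chi> s. area_factor (face_lin R (face_index R s)) (axis (face_coord R) 1))"

definition mass :: "('d::finite, 'p::finite, 'q::finite, 's::finite, 'g::finite) ref_element \<Rightarrow> real^'p^'p" where
  "mass R = transpose (Vq R) ** Wq R ** Vq R"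

definition Pq :: "('d::finite, 'p::finite, 'q::finite, 's::finite, 'g::finite) ref_element \<Rightarrow> real^'q^'p" where
  "Pq R = matrix_inv (mass R) ** transpose (Vq R) ** Wq R"

definition Lq :: "('d::finite, 'p::finite, 'q::finite, 's::finite, 'g::finite) ref_element \<Rightarrow> real^'s^'p" where
  "Lq R = matrix_inv (mass R) ** transpose (Vf R) ** Wf R"

definition DN :: "('d::finite, 'p::finite, 'q::finite, 's::finite, 'g::finite) ref_element \<Rightarrow> 'd \<Rightarrow> real^('q + 's)^('q + 's)" where
  "DN R i = block_matrix
     (Vq R ** diff_matrix R i ** Pq R
        - (1/2) *\<^sub>R (Vq R ** Lq R ** diag (nhat R i * Jhat R) ** Vf R ** Pq R))
     ((1/2) *\<^sub>R (Vq R ** Lq R ** diag (nhat R i * Jhat R)))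
     (- ((1/2) *\<^sub>R (diag (nhat R i * Jhat R) ** Vf R ** Pq R)))
     ((1/2) *\<^sub>R diag (nhat R i * Jhat R))"

definition WN :: "('d::finite, 'p::finite, 'q::finite, 's::finite, 'g::finite) ref_element \<Rightarrow> real^('q + 's)^('q + 's)" where
  "WN R = block_matrix (Wq R) 0 0 (Wf R)"

text \<open>
  Exactness of the volume rule is required for all degrees \<open>m \<le> 2N - 1\<close>, written \<open>m < 2 * N\<close> so that
  it is void for \<open>N = 0\<close>.
\<close>

locale reference_element =
  fixes R :: "('d::finite, 'p::finite, 'q::finite, 's::finite, 'g::finite) ref_element"
  assumes Dhat_compact: "compact (Dhat R)"
    and Dhat_nonempty: "Dhat R \<noteq> {}"
    and Dhat_regular: "closure (interior (Dhat R)) = Dhat R"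
    and ref_face_compact: "compact (ref_face R g)"
    and ref_face_hyperplane: "affine hull (ref_face R g) = {y. y $ face_coord R = 0}"
    and face_lin_invertible: "invertible (face_lin R g)"
    and frontier_Dhat: "frontier (Dhat R) = (\<Union>g. face R g)"
    and faces_distinct: "g \<noteq> g' \<Longrightarrow> rel_interior (face R g) \<inter> rel_interior (face R g') = {}"
    and face_normal_unit: "norm (face_normal R g) = 1"
    and face_normal_orthogonal:
      "x \<in> face R g \<Longrightarrow> y \<in> face R g \<Longrightarrow> face_normal R g \<bullet> (x - y) = 0"
    and face_normal_outward:
      "x \<in> rel_interior (face R g) \<Longrightarrow>
         \<exists>\<epsilon>>0. \<forall>\<delta>. 0 < \<delta> \<and> \<delta> < \<epsilon> \<longrightarrow>
           x + \<delta> *\<^sub>R face_normal R g \<notin> Dhat R \<and> x - \<delta> *\<^sub>R face_normal R g \<in> Dhat R"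
    and basis: "bij_betw (expand R) UNIV (poly_space (deg R))"
    and diff_matrix: "expand R (diff_matrix R i *v c) x = partial i (expand R c) x"
    and vol_point: "vol_point R a \<in> Dhat R"
    and vol_weight_pos: "vol_weight R $ a > 0"
    and surf_point: "surf_point R s \<in> face R (face_index R s)"
    and vol_exact: "m < 2 * deg R \<Longrightarrow> p \<in> poly_space m \<Longrightarrow>
        (p has_integral (\<Sum>a\<in>UNIV. vol_weight R $ a * p (vol_point R a))) (Dhat R)"
    and integration_by_parts: "p \<in> poly_space (deg R) \<Longrightarrow> r \<in> poly_space (deg R) \<Longrightarrow>
        (\<Sum>a\<in>UNIV. vol_weight R $ a * (partial i p (vol_point R a) * r (vol_point R a))) =
        (\<Sum>s\<in>UNIV. surf_weight R $ s * Jhat R $ s *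
            (p (surf_point R s) * r (surf_point R s) * nhat R i $ s))
        - (\<Sum>a\<in>UNIV. vol_weight R $ a * (p (vol_point R a) * partial i r (vol_point R a)))"
    and mass_pos_def: "c \<noteq> 0 \<Longrightarrow> c \<bullet> (mass R *v c) > 0"

section \<open>The curved mesh\<close>

text \<open>
  \<open>geo X k i j\<close> is the vector of values, at all quadrature points, of the (possibly approximate)
  geometric term \<open>J \<partial>xhat\<^sub>j/\<partial>x\<^sub>i\<close> on the element \<open>k\<close>.
\<close>

record ('d, 'k, 'q, 's) curved_mesh =
  domain :: "(real^'d) set"
  elem_map :: "'k \<Rightarrow> real^'d \<Rightarrow> real^'d"
  geo :: "'k \<Rightarrow> 'd \<Rightarrow> 'd \<Rightarrow> real^('q::finite + 's::finite)"

definition elem_jacobian ::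
  "('d::finite, 'k::finite, 'q::finite, 's::finite) curved_mesh \<Rightarrow> 'k \<Rightarrow> real^'d \<Rightarrow> real^'d^'d" where
  "elem_jacobian X k x = jacobian (elem_map X k) (at x)"

definition Jvol :: "('d::finite, 'p::finite, 'q::finite, 's::finite, 'g::finite) ref_element \<Rightarrow>
    ('d, 'k::finite, 'q, 's) curved_mesh \<Rightarrow> 'k \<Rightarrow> real^'q" where
  "Jvol R X k = (\<chi> a. det (elem_jacobian X k (vol_point R a)))"

text \<open>
  The outward unit normal of the mapped element is the normalization of the inverse transpose of the
  Jacobian matrix applied to the reference normal, as the Jacobian determinant is positive.  The face Jacobian factor is the area factor of the composite map
  from the reference face to the face of the mapped element.
\<close>

definition normal_vec :: "('d::finite, 'p::finite, 'q::finite, 's::finite, 'g::finite) ref_element \<Rightarrow>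
    ('d, 'k::finite, 'q, 's) curved_mesh \<Rightarrow> 'k \<Rightarrow> 's \<Rightarrow> real^'d" where
  "normal_vec R X k s =
     sgn (transpose (matrix_inv (elem_jacobian X k (surf_point R s))) *v face_normal R (face_index R s))"

definition nsurf :: "('d::finite, 'p::finite, 'q::finite, 's::finite, 'g::finite) ref_element \<Rightarrow>
    ('d, 'k::finite, 'q, 's) curved_mesh \<Rightarrow> 'k \<Rightarrow> 'd \<Rightarrow> real^'s" where
  "nsurf R X k i = (\<chi> s. normal_vec R X k s $ i)"

definition Jsurf :: "('d::finite, 'p::finite, 'q::finite, 's::finite, 'g::finite) ref_element \<Rightarrow>
    ('d, 'k::finite, 'q, 's) curved_mesh \<Rightarrow> 'k \<Rightarrow> real^'s" where
  "Jsurf R X k = (\<chi> s. area_factor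
     (elem_jacobian X k (surf_point R s) ** face_lin R (face_index R s)) (axis (face_coord R) 1))"

definition interior_face :: "('d::finite, 'p::finite, 'q::finite, 's::finite, 'g::finite) ref_element \<Rightarrow>
    ('d, 'k::finite, 'q, 's) curved_mesh \<Rightarrow> 'k \<Rightarrow> 'g \<Rightarrow> bool" where
  "interior_face R X k g \<longleftrightarrow> \<not> elem_map X k ` face R g \<subseteq> frontier (domain X)"

definition shared_face :: "('d::finite, 'p::finite, 'q::finite, 's::finite, 'g::finite) ref_element \<Rightarrow>
    ('d, 'k::finite, 'q, 's) curved_mesh \<Rightarrow> 'k \<times> 'g \<Rightarrow> 'k \<times> 'g \<Rightarrow> bool" where
  "shared_face R X = (\<lambda>(k, g) (k', g').
     interior_face R X k g \<and> k \<noteq> k' \<and> elem_map X k ` face R g = elem_map X k' ` face R g')"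

text \<open>
  \<open>neighbor R X (k, s) (k', s')\<close>: the surface point \<open>s'\<close> of \<open>k'\<close> is the point \<open>s\<close> of \<open>k\<close> seen from
  across the face.  Requiring only equal positions would not suffice, since points of
  different faces may coincide on edges and at vertices.
\<close>

definition neighbor :: "('d::finite, 'p::finite, 'q::finite, 's::finite, 'g::finite) ref_element \<Rightarrow>
    ('d, 'k::finite, 'q, 's) curved_mesh \<Rightarrow> 'k \<times> 's \<Rightarrow> 'k \<times> 's \<Rightarrow> bool" where
  "neighbor R X = (\<lambda>(k, s) (k', s').
     shared_face R X (k, face_index R s) (k', face_index R s') \<and>
     elem_map X k (surf_point R s) = elem_map X k' (surf_point R s'))"

locale mesh =
  fixes R :: "('d::finite, 'p::finite, 'q::finite, 's::finite, 'g::finite) ref_element"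
    and X :: "('d, 'k::finite, 'q, 's) curved_mesh"
    and \<kappa> :: real
  assumes domain_open: "open (domain X)"
    and decomposition: "closure (domain X) = (\<Union>k. elem_map X k ` Dhat R)"
    and elements_disjoint: "k \<noteq> k' \<Longrightarrow>
        interior (elem_map X k ` Dhat R) \<inter> interior (elem_map X k' ` Dhat R) = {}"
    and elem_map_smooth: "\<exists>S. Dhat R \<subseteq> S \<and> smooth_on (elem_map X k) S"
    and elem_map_inj: "inj_on (elem_map X k) (Dhat R)"
    and elem_jacobian_pos: "x \<in> Dhat R \<Longrightarrow> det (elem_jacobian X k x) > 0"
    and quasi_uniform: "\<kappa> > 0"
        "\<exists>c. ball c (diameter (elem_map X k' ` Dhat R) / \<kappa>) \<subseteq> elem_map X k ` Dhat R"
    and watertight: "interior_face R X k g \<Longrightarrow> \<exists>!kg. shared_face R X (k, g) kg"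
    and points_match: "shared_face R X (k, face_index R s) (k', g') \<Longrightarrow>
        \<exists>!s'. face_index R s' = g' \<and> elem_map X k (surf_point R s) = elem_map X k' (surf_point R s')"
    and weights_match: "neighbor R X (k, s) (k', s') \<Longrightarrow> surf_weight R $ s = surf_weight R $ s'"
    and normals_match: "neighbor R X (k, s) (k', s') \<Longrightarrow>
        Jsurf R X k $ s *\<^sub>R normal_vec R X k s = - (Jsurf R X k' $ s' *\<^sub>R normal_vec R X k' s')"
    and geo_surf: "(\<Sum>j\<in>UNIV. surf_part (geo X k i j) * (nhat R j * Jhat R)) = nsurf R X k i * Jsurf R X k"

definition Dk :: "('d::finite, 'p::finite, 'q::finite, 's::finite, 'g::finite) ref_element \<Rightarrow>
    ('d, 'k::finite, 'q, 's) curved_mesh \<Rightarrow> 'k \<Rightarrow> 'd \<Rightarrow> real^('q + 's)^('q + 's)" where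
  "Dk R X k i = (1/2) *\<^sub>R (\<Sum>j\<in>UNIV. diag (geo X k i j) ** DN R j + DN R j ** diag (geo X k i j))"

definition Qk :: "('d::finite, 'p::finite, 'q::finite, 's::finite, 'g::finite) ref_element \<Rightarrow>
    ('d, 'k::finite, 'q, 's) curved_mesh \<Rightarrow> 'k \<Rightarrow> 'd \<Rightarrow> real^('q + 's)^('q + 's)" where
  "Qk R X k i = WN R ** Dk R X k i"

definition mass_invJ :: "('d::finite, 'p::finite, 'q::finite, 's::finite, 'g::finite) ref_element \<Rightarrow>
    ('d, 'k::finite, 'q, 's) curved_mesh \<Rightarrow> 'k \<Rightarrow> real^'p^'p" where
  "mass_invJ R X k = transpose (Vq R) ** Wq R ** diag (pointwise (\<lambda>J. 1 / J) (Jvol R X k)) ** Vq R"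

definition Ptilde :: "('d::finite, 'p::finite, 'q::finite, 's::finite, 'g::finite) ref_element \<Rightarrow>
    ('d, 'k::finite, 'q, 's) curved_mesh \<Rightarrow> 'k \<Rightarrow> real^'q^'p" where
  "Ptilde R X k = matrix_inv (mass R) ** mass_invJ R X k ** matrix_inv (mass R)
     ** transpose (Vq R) ** Wq R ** diag (Jvol R X k)"

definition Ltilde :: "('d::finite, 'p::finite, 'q::finite, 's::finite, 'g::finite) ref_element \<Rightarrow>
    ('d, 'k::finite, 'q, 's) curved_mesh \<Rightarrow> 'k \<Rightarrow> real^'s^'p" where
  "Ltilde R X k = matrix_inv (mass R) ** mass_invJ R X k ** matrix_inv (mass R)
     ** transpose (Vf R) ** Wf R ** diag (Jsurf R X k)"

definition Wboundary :: "('d::finite, 'p::finite, 'q::finite, 's::finite, 'g::finite) ref_element \<Rightarrow>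
    ('d, 'k::finite, 'q, 's) curved_mesh \<Rightarrow> 'k \<Rightarrow> real^'s^'s" where
  "Wboundary R X k = diag (\<chi> s.
     if elem_map X k (surf_point R s) \<in> frontier (domain X) then surf_weight R $ s else 0)"

section \<open>Entropy and entropy conservative fluxes\<close>

text \<open>
  \<open>A\<close> is the set of admissible states, on which all maps are defined and smooth; \<open>v\<close> are the
  entropy variables, with inverse \<open>u\<close> defined on \<open>v ` A\<close>.
\<close>

locale entropy_system =
  fixes A :: "(real^'n) set"
    and U :: "real^'n \<Rightarrow> real"
    and v u :: "real^'n \<Rightarrow> real^'n"
    and f :: "'d::finite \<Rightarrow> real^'n \<Rightarrow> real^'n"
    and F :: "'d \<Rightarrow> real^'n \<Rightarrow> real"
  assumes U_smooth: "smooth_on U A"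
    and U_convex: "convex_on A U"
    and entropy_variables: "w \<in> A \<Longrightarrow> GDERIV U w :> v w"
    and u_smooth: "smooth_on u (v ` A)"
    and u_inverse: "w \<in> A \<Longrightarrow> u (v w) = w"
    and f_smooth: "smooth_on (f j) A"
    and F_smooth: "smooth_on (F j) A"
    and entropy_flux: "w \<in> A \<Longrightarrow> GDERIV (F j) w :> (v w v* jacobian (f j) (at w))"

definition potential ::
  "(real^'n \<Rightarrow> real^'n) \<Rightarrow> (real^'n \<Rightarrow> real^'n) \<Rightarrow> (real^'n \<Rightarrow> real) \<Rightarrow> real^'n \<Rightarrow> real" where
  "potential u fj Fj z = z \<bullet> fj (u z) - Fj (u z)"

definition entropy_conservative_flux ::
  "(real^'n) set \<Rightarrow> (real^'n \<Rightarrow> real^'n) \<Rightarrow> (real^'n \<Rightarrow> real^'n) \<Rightarrow> (real^'n \<Rightarrow> real^'n) \<Rightarrow>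
   (real^'n \<Rightarrow> real) \<Rightarrow> (real^'n \<Rightarrow> real^'n \<Rightarrow> real^'n) \<Rightarrow> bool" where
  "entropy_conservative_flux A v u fj Fj fS \<longleftrightarrow>
     (\<forall>uL\<in>A. \<forall>uR\<in>A. fS uL uR = fS uR uL) \<and>
     (\<forall>w\<in>A. fS w w = fj w) \<and>
     (\<forall>uL\<in>A. \<forall>uR\<in>A. (v uL - v uR) \<bullet> fS uL uR = potential u fj Fj (v uL) - potential u fj Fj (v uR))"

end

theory Submission
  imports Defs
begin

text \<open>
  The entropy production of the scheme is found by testing it with the entropy variables.  The chain
  rule turns the time derivative of the total entropy of one element into the weighted product of
  \<open>J v(u\<^sub>q)\<close> with \<open>V\<^sub>q du\<^sub>h/dt\<close>.  The weight-adjusted mass matrix is symmetric, so this product is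
  minus the product of the projected entropy variables \<open>v\<^sub>h\<close> with the weighted flux terms of the scheme
  (\<open>element_entropy_balance\<close>).

  The volume fluxes contribute only on the surface.  Quadrature-based integration by parts gives
  \<open>Q + Q\<^sup>T = B\<close> for the matrix \<open>Q\<close> of the split form, where \<open>B\<close> is diagonal and supported on the
  surface points (\<open>DN_sbp\<close>, \<open>Qk_sbp\<close>).  Together with \<open>Q 1 = 0\<close> and the entropy condition for the
  two-point fluxes this reduces the volume term to the surface sum of \<open>v\<^sup>T f - \<psi>\<close>
  (\<open>flux_differencing\<close>).  Adding the interface term leaves the surface sum of
  \<open>n\<^sub>j J\<^sub>f w (\<psi>\<^sub>j - v\<^sup>T f\<^sub>j\<^sup>*)\<close> on each element.

  In the sum over all elements every point away from the boundary of the domain meets its neighbor on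
  the adjacent element.  The scaled normals are opposite there, and \<open>\<psi>\<^sub>j - v\<^sup>T f\<^sub>j\<^sup>*\<close> agrees on both
  sides, again by the entropy condition, so the two contributions cancel
  (\<open>sum_off_boundary_cancel\<close>) and the boundary terms remain.
\<close>

section \<open>Matrix algebra\<close>

lemma matrix_add_rdistrib: "(A + B) ** C = A ** C + B ** (C :: real^'n^'m)"
  by (simp add: matrix_matrix_mult_def vec_eq_iff algebra_simps sum.distrib)

lemma matrix_diff_ldistrib: "A ** (B - C) = A ** B - A ** (C :: real^'n^'m)"
  by (simp add: matrix_matrix_mult_def vec_eq_iff algebra_simps sum_subtractf)

lemma matrix_diff_rdistrib: "(A - B) ** C = A ** C - B ** (C :: real^'n^'m)"
  by (simp add: matrix_matrix_mult_def vec_eq_iff algebra_simps sum_subtractf)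

lemma matrix_sum_ldistrib: "A ** (\<Sum>i\<in>S. B i) = (\<Sum>i\<in>S. A ** (B i :: real^'n^'m))"
  by (induction S rule: infinite_finite_induct) (simp_all add: matrix_add_ldistrib)

lemma transpose_add: "transpose (A + B) = transpose A + transpose B"
  by (simp add: transpose_def vec_eq_iff)

lemma transpose_sum: "transpose (\<Sum>i\<in>S. B i) = (\<Sum>i\<in>S. transpose (B i))"
  by (induction S rule: infinite_finite_induct) (simp_all add: transpose_add, simp_all add: transpose_def vec_eq_iff)

text \<open>
  The componentwise action of a scalar matrix on vectors of states has the transposed matrix as its
  adjoint, as in the scalar case; this moves every operator of the scheme onto the entropy variables.
\<close>

lemma inner_matrix_mult: "(A ** X) \<bullet> Y = X \<bullet> (transpose A ** (Y :: real^'n^'q))"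
  for A :: "real^'p^'q"
proof -
  have "(A ** X) \<bullet> Y = (\<Sum>i\<in>UNIV. \<Sum>c\<in>UNIV. \<Sum>j\<in>UNIV. A $ i $ j * X $ j $ c * Y $ i $ c)"
    by (simp add: inner_vec_def matrix_matrix_mult_def sum_distrib_right)
  also have "\<dots> = (\<Sum>i\<in>UNIV. \<Sum>j\<in>UNIV. \<Sum>c\<in>UNIV. A $ i $ j * X $ j $ c * Y $ i $ c)"
    by (rule sum.cong[OF refl]) (rule sum.swap)
  also have "\<dots> = (\<Sum>j\<in>UNIV. \<Sum>i\<in>UNIV. \<Sum>c\<in>UNIV. A $ i $ j * X $ j $ c * Y $ i $ c)"
    by (rule sum.swap)
  also have "\<dots> = (\<Sum>j\<in>UNIV. \<Sum>c\<in>UNIV. \<Sum>i\<in>UNIV. A $ i $ j * X $ j $ c * Y $ i $ c)"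
    by (rule sum.cong[OF refl]) (rule sum.swap)
  also have "\<dots> = X \<bullet> (transpose A ** Y)"
    by (simp add: inner_vec_def matrix_matrix_mult_def transpose_def sum_distrib_left mult_ac)
  finally show ?thesis .
qed

lemma inner_matrix_vector_mult: "(A *v x) \<bullet> y = x \<bullet> (transpose A *v y)"
  for A :: "real^'p^'q"
  by (metis dot_lmul_matrix inner_commute transpose_matrix_vector)

lemma matrix_inv_inverse:
  fixes A :: "real^'n^'n"
  assumes "invertible A"
  shows "A ** matrix_inv A = mat 1" and "matrix_inv A ** A = mat 1"
  using someI_ex[OF assms[unfolded invertible_def]] by (auto simp: matrix_inv_def)

lemma transpose_matrix_inv:
  fixes A :: "real^'n^'n"
  assumes "invertible A" and "transpose A = A"
  shows "transpose (matrix_inv A) = matrix_inv A"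
proof -
  have "transpose (matrix_inv A) ** A = mat 1"
    using matrix_inv_inverse(1)[OF assms(1)] matrix_transpose_mul[of A "matrix_inv A"] assms(2) by simp
  then show ?thesis
    by (metis assms(1) matrix_inv_inverse(1) matrix_mul_assoc matrix_mul_lid matrix_mul_rid)
qed

lemma diag_mult_component: "(diag x ** Y) $ i = x $ i *\<^sub>R (Y $ i :: real^'n)"
  by (simp add: diag_def matrix_matrix_mult_def vec_eq_iff if_distrib if_distribR sum.delta cong: if_cong)

lemma mult_diag_component: "(A ** diag x) $ i $ j = A $ i $ j * x $ j"
  by (simp add: diag_def matrix_matrix_mult_def if_distrib if_distribR sum.delta cong: if_cong)

lemma diag_mult_vector: "diag x *v y = x * y"
  by (simp add: diag_def matrix_vector_mult_def vec_eq_iff if_distrib if_distribR sum.delta cong: if_cong)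

lemma diag_mult_diag: "diag x ** diag y = diag (x * y)"
  by (simp add: vec_eq_iff mult_diag_component) (simp add: diag_def)

lemma transpose_diag [simp]: "transpose (diag x) = diag x"
  by (simp add: diag_def transpose_def vec_eq_iff)

lemma diag_sum: "diag (\<Sum>i\<in>S. x i) = (\<Sum>i\<in>S. diag (x i))"
  by (simp add: diag_def vec_eq_iff)

lemma diag_mult_block: "diag (vcat x y) ** block_matrix A B C D
    = block_matrix (diag x ** A) (diag x ** B) (diag y ** C) (diag y ** D)"
  by (simp add: vec_eq_iff diag_mult_component block_matrix_def vcat_def hcat_def split: sum.split)

lemma block_matrix_diag: "block_matrix (diag x) 0 0 (diag y) = diag (vcat x y)"
  by (auto simp: vec_eq_iff diag_def block_matrix_def vcat_def hcat_def split: sum.split)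

lemma transpose_block:
  "transpose (block_matrix A B C D) = block_matrix (transpose A) (transpose C) (transpose B) (transpose D)"
  by (simp add: vec_eq_iff transpose_def block_matrix_def vcat_def hcat_def split: sum.split)

lemma block_matrix_add:
  "block_matrix A B C D + block_matrix A' B' C' D' = block_matrix (A + A') (B + B') (C + C') (D + D')"
  by (simp add: vec_eq_iff block_matrix_def vcat_def hcat_def split: sum.split)

text \<open>
  Testing with \<open>[V\<^sup>T W, V'\<^sup>T W']\<close> amounts to evaluating at all volume and surface points and
  weighting there.
\<close>

lemma hcat_transpose_diag:
  "hcat (transpose V ** diag x) (transpose V' ** diag y) = transpose (vcat V V') ** diag (vcat x y)"
  by (simp add: vec_eq_iff mult_diag_component hcat_def vcat_def transpose_def split: sum.split)

lemma inner_weighted_gram: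
  "e \<bullet> ((transpose V ** diag w ** V') *v c) = (\<Sum>a\<in>UNIV. w $ a * ((V *v e) $ a * (V' *v c) $ a))"
proof -
  have "e \<bullet> ((transpose V ** diag w ** V') *v c) = (V *v e) \<bullet> (diag w *v (V' *v c))"
    by (simp add: inner_matrix_vector_mult matrix_vector_mul_assoc matrix_mul_assoc)
  also have "\<dots> = (\<Sum>a\<in>UNIV. w $ a * ((V *v e) $ a * (V' *v c) $ a))"
    by (simp add: diag_mult_vector inner_vec_def mult_ac)
  finally show ?thesis .
qed

section \<open>Summation by parts on the reference element\<close>

context reference_element
begin

lemma mass_eq: "mass R = transpose (Vq R) ** diag (vol_weight R) ** Vq R"
  by (simp add: mass_def Wq_def)

lemma transpose_mass: "transpose (mass R) = mass R"
  by (simp add: mass_eq matrix_transpose_mul matrix_mul_assoc)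

lemma invertible_mass: "invertible (mass R)"
proof -
  have "c = 0" if "mass R *v c = 0" for c
    using mass_pos_def[of c] that by force
  then show ?thesis
    using invertible_left_inverse matrix_left_invertible_ker by blast
qed

lemma transpose_mass_inv: "transpose (matrix_inv (mass R)) = matrix_inv (mass R)"
  by (rule transpose_matrix_inv[OF invertible_mass transpose_mass])

lemma Vq_mult: "(Vq R *v c) $ a = expand R c (vol_point R a)"
  by (simp add: Vq_def expand_def matrix_vector_mult_def mult.commute)

lemma Vf_mult: "(Vf R *v c) $ s = expand R c (surf_point R s)"
  by (simp add: Vf_def expand_def matrix_vector_mult_def mult.commute)

text \<open>
  Integration by parts under quadrature, tested on all pairs of polynomials of the approximation
  space: the volume terms are the bilinear form of \<open>M D\<^sub>i\<close> and of its transpose.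
\<close>

lemma mass_diff_matrix_sbp:
  "mass R ** diff_matrix R i + transpose (mass R ** diff_matrix R i)
   = transpose (Vf R) ** diag (surf_weight R * (nhat R i * Jhat R)) ** Vf R" (is "?K + _ = ?C")
proof -
  have poly: "expand R c \<in> poly_space (deg R)" for c
    using basis by (auto simp: bij_betw_def)
  have K: "e \<bullet> (?K *v c)
      = (\<Sum>a\<in>UNIV. vol_weight R $ a * (expand R e (vol_point R a) * partial i (expand R c) (vol_point R a)))" for e c
  proof -
    have "?K = transpose (Vq R) ** diag (vol_weight R) ** (Vq R ** diff_matrix R i)"
      by (simp add: mass_eq matrix_mul_assoc)
    moreover have "((Vq R ** diff_matrix R i) *v c) $ a = partial i (expand R c) (vol_point R a)" for a
      by (simp add: Vq_mult diff_matrix flip: matrix_vector_mul_assoc)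
    ultimately show ?thesis
      by (simp add: inner_weighted_gram Vq_mult)
  qed
  have "e \<bullet> ((?K + transpose ?K) *v c) = e \<bullet> (?C *v c)" for e c
  proof -
    have "e \<bullet> ((?K + transpose ?K) *v c) = e \<bullet> (?K *v c) + c \<bullet> (?K *v e)"
      by (simp only: matrix_vector_mult_add_rdistrib inner_add_right inner_matrix_vector_mult[symmetric]
          inner_commute[of c])
    also have "\<dots> = e \<bullet> (?C *v c)"
      using integration_by_parts[OF poly[of c] poly[of e], of i]
      by (simp add: K inner_weighted_gram Vf_mult mult_ac)
    finally show ?thesis .
  qed
  then show ?thesis
    by (metis matrix_eq vector_eq_rdot inner_commute)
qed

lemma WN_eq: "WN R = diag (vcat (vol_weight R) (surf_weight R))"
  by (simp add: WN_def Wq_def Wf_def block_matrix_diag)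

text \<open>
  The decoupled operator keeps the integration by parts property on quadrature points, with a
  boundary term that is diagonal.  Since \<open>P\<^sub>q\<^sup>T M = W V\<^sub>q\<close>, the volume block of \<open>W\<^sub>N D\<^sub>N\<close> is
  \<open>P\<^sub>q\<^sup>T (M D\<^sub>i - C / 2) P\<^sub>q\<close>, where \<open>C = M D\<^sub>i + (M D\<^sub>i)\<^sup>T\<close> is the surface
  matrix of \<open>mass_diff_matrix_sbp\<close>; subtracting half of \<open>C\<close> makes this block skew-symmetric.  The two
  off-diagonal blocks are negative transposes of each other, so only the diagonal surface block
  contributes to the symmetric part.
\<close>

lemma DN_sbp:
  "WN R ** DN R i + transpose (WN R ** DN R i) = diag (vcat 0 (surf_weight R * (nhat R i * Jhat R)))"
proof -
  let ?n = "nhat R i * Jhat R"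
  let ?E = "diag (surf_weight R * ?n)"
  let ?B = "Vf R ** Pq R"
  let ?Y = "mass R ** diff_matrix R i - (1/2) *\<^sub>R (transpose (Vf R) ** ?E ** Vf R)"
  have Pt: "transpose (Pq R) = Wq R ** Vq R ** matrix_inv (mass R)"
    by (simp add: Pq_def Wq_def matrix_transpose_mul transpose_mass_inv matrix_mul_assoc)
  have PtM: "transpose (Pq R) ** mass R = Wq R ** Vq R"
    using matrix_inv_inverse(2)[OF invertible_mass] by (simp add: Pt flip: matrix_mul_assoc)
  \<comment> \<open>Lifting from the surface is adjoint to evaluating the projection there.\<close>
  have WVL: "Wq R ** Vq R ** Lq R ** diag ?n = transpose ?B ** ?E"
    by (simp add: matrix_transpose_mul Pt Lq_def Wf_def diag_mult_diag flip: matrix_mul_assoc)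
  have A: "Wq R ** (Vq R ** diff_matrix R i ** Pq R
        - (1/2) *\<^sub>R (Vq R ** Lq R ** diag ?n ** Vf R ** Pq R)) = transpose (Pq R) ** ?Y ** Pq R"
  proof -
    have "Wq R ** Vq R ** diff_matrix R i ** Pq R = transpose (Pq R) ** (mass R ** diff_matrix R i) ** Pq R"
      by (simp add: matrix_mul_assoc PtM)
    moreover have "Wq R ** Vq R ** Lq R ** diag ?n ** Vf R ** Pq R
        = transpose (Pq R) ** (transpose (Vf R) ** ?E ** Vf R) ** Pq R"
      by (simp add: WVL matrix_transpose_mul matrix_mul_assoc)
    ultimately show ?thesis
      by (simp add: matrix_diff_ldistrib matrix_diff_rdistrib matrix_scalar_ac matrix_mul_assoc
          flip: scalar_matrix_assoc)
  qed
  have WD: "WN R ** DN R i = block_matrix (transpose (Pq R) ** ?Y ** Pq R)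
      ((1/2) *\<^sub>R (transpose ?B ** ?E)) (- ((1/2) *\<^sub>R (?E ** ?B))) ((1/2) *\<^sub>R ?E)"
  proof -
    have "Wf R ** - ((1/2) *\<^sub>R (diag ?n ** Vf R ** Pq R)) = - ((1/2) *\<^sub>R (?E ** ?B))"
      by (simp add: vec_eq_iff Wf_def diag_mult_component diag_mult_diag flip: matrix_mul_assoc)
    moreover have "Wf R ** ((1/2) *\<^sub>R diag ?n) = (1/2) *\<^sub>R ?E"
      by (simp add: Wf_def matrix_scalar_ac diag_mult_diag flip: scalar_matrix_assoc)
    moreover have "Wq R ** ((1/2) *\<^sub>R (Vq R ** Lq R ** diag ?n)) = (1/2) *\<^sub>R (transpose ?B ** ?E)"
      by (simp add: matrix_scalar_ac matrix_mul_assoc WVL flip: scalar_matrix_assoc)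
    ultimately show ?thesis
      using A by (simp add: WN_eq DN_def diag_mult_block Wq_def Wf_def)
  qed
  have "?Y + transpose ?Y = 0"
  proof -
    have "(K - (1/2) *\<^sub>R C) + transpose (K - (1/2) *\<^sub>R C) = 0"
      if "K + transpose K = C" for K C :: "real^'p^'p"
      by (simp add: vec_eq_iff transpose_def field_simps flip: that)
    then show ?thesis
      using mass_diff_matrix_sbp[of i] by blast
  qed
  moreover have "transpose P ** Y ** P + transpose (transpose P ** Y ** P) = transpose P ** (Y + transpose Y) ** P"
    for P :: "real^'q^'p" and Y
    by (simp add: matrix_transpose_mul matrix_mul_assoc matrix_add_ldistrib matrix_add_rdistrib)
  ultimately have "transpose (Pq R) ** ?Y ** Pq R + transpose (transpose (Pq R) ** ?Y ** Pq R) = 0"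
    by (simp only: times0_left times0_right)
  moreover have "transpose (- ((1/2) *\<^sub>R (?E ** ?B))) = - ((1/2) *\<^sub>R (transpose ?B ** ?E))"
    by (simp add: vec_eq_iff transpose_def mult_diag_component diag_mult_component)
  moreover have "transpose ((1/2) *\<^sub>R (transpose ?B ** ?E)) = ((1/2) *\<^sub>R (?E ** ?B))"
    by (simp add: transpose_scalar matrix_transpose_mul)
  moreover have "transpose ((1/2) *\<^sub>R ?E) = (1/2) *\<^sub>R ?E"
    by (simp add: transpose_scalar)
  moreover have "(1/2) *\<^sub>R ?E + (1/2) *\<^sub>R ?E = ?E"
    by (simp flip: scaleR_left_distrib)
  moreover have "block_matrix 0 0 0 ?E = diag (vcat 0 (surf_weight R * ?n))"
    by (auto simp: vec_eq_iff diag_def block_matrix_def vcat_def hcat_def split: sum.split)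
  ultimately show ?thesis
    by (simp only: WD transpose_block block_matrix_add add.right_inverse add.left_inverse)
qed

end

text \<open>
  The split form on a curved element inherits the property: averaging the multiplication by the
  geometric terms on the left and on the right commutes with taking transposes.  The diagonal
  boundary term is multiplied by the geometric terms at the surface points, and these turn the
  scaled reference normals into the scaled physical normals.
\<close>

lemma Qk_sbp:
  assumes "reference_element R" and "mesh R X \<kappa>"
  shows "Qk R X k i + transpose (Qk R X k i) = diag (vcat 0 (surf_weight R * (nsurf R X k i * Jsurf R X k)))"
proof -
  interpret reference_element R by fact
  interpret mesh R X \<kappa> by fact
  let ?G = "\<lambda>j. geo X k i j"
  let ?Q = "\<lambda>j. WN R ** DN R j"
  let ?e = "\<lambda>j. surf_weight R * (nhat R j * Jhat R)"
  have WD: "WN R ** (diag (?G j) ** DN R j + DN R j ** diag (?G j)) = diag (?G j) ** ?Q j + ?Q j ** diag (?G j)" for j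
    by (simp add: matrix_add_ldistrib matrix_mul_assoc WN_eq diag_mult_diag mult.commute)
  have "Qk R X k i = (1/2) *\<^sub>R (\<Sum>j\<in>UNIV. diag (?G j) ** ?Q j + ?Q j ** diag (?G j))"
    by (simp add: Qk_def Dk_def matrix_scalar_ac matrix_sum_ldistrib WD scaleR_right.sum
        flip: scalar_matrix_assoc)
  moreover have "transpose (diag (?G j) ** ?Q j + ?Q j ** diag (?G j))
       = diag (?G j) ** transpose (?Q j) + transpose (?Q j) ** diag (?G j)" for j
    by (simp add: transpose_add matrix_transpose_mul matrix_mul_assoc add.commute)
  ultimately have "Qk R X k i + transpose (Qk R X k i) = (1/2) *\<^sub>R (\<Sum>j\<in>UNIV.
      diag (?G j) ** (?Q j + transpose (?Q j)) + (?Q j + transpose (?Q j)) ** diag (?G j))"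
    by (simp add: transpose_scalar transpose_sum matrix_add_ldistrib matrix_add_rdistrib
        scaleR_right_distrib[symmetric] sum.distrib[symmetric] algebra_simps)
  also have "\<dots> = (1/2) *\<^sub>R (\<Sum>j\<in>UNIV. 2 *\<^sub>R diag (vcat 0 (?e j) * ?G j))"
    by (simp add: DN_sbp diag_mult_diag mult.commute scaleR_2)
  also have "\<dots> = diag (\<Sum>j\<in>UNIV. vcat 0 (?e j) * ?G j)"
    by (simp add: diag_sum flip: scaleR_right.sum)
  also have "(\<Sum>j\<in>UNIV. vcat 0 (?e j) * ?G j)
      = vcat 0 (surf_weight R * (\<Sum>j\<in>UNIV. surf_part (?G j) * (nhat R j * Jhat R)))"
    by (simp add: vec_eq_iff vcat_def surf_part_def sum_distrib_left mult_ac split: sum.split)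
  finally show ?thesis
    by (simp only: geo_surf)
qed

section \<open>Flux differencing\<close>

text \<open>
  The discrete counterpart of integrating \<open>v\<^sup>T \<partial>f/\<partial>x = \<partial>(v\<^sup>T f - \<psi>)/\<partial>x\<close>.  The symmetric part of
  \<open>Q\<close> only sees the diagonal of \<open>G\<close>.  In the skew part the symmetry of \<open>G\<close> replaces \<open>V\<^sub>i\<close> by the
  jump \<open>V\<^sub>i - V\<^sub>j\<close>, so that only the jumps \<open>\<psi>\<^sub>i - \<psi>\<^sub>j\<close> are left.  Since the rows of \<open>Q\<close> sum to \<open>0\<close>,
  its columns sum to \<open>b\<close>, and everything reduces to boundary terms.
\<close>

lemma flux_differencing:
  fixes Q :: "real^'m^'m" and V :: "real^'n^'m"
  assumes sbp: "Q + transpose Q = diag b" and Q1: "Q *v 1 = 0"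
    and sym: "\<And>i j. G $ i $ j = G $ j $ i"
    and shuffle: "\<And>i j. (V $ i - V $ j) \<bullet> G $ i $ j = \<psi> $ i - \<psi> $ j"
  shows "V \<bullet> hadamard_ones (2 *\<^sub>R Q) G = (\<Sum>i\<in>UNIV. b $ i * (V $ i \<bullet> G $ i $ i - \<psi> $ i))"
proof -
  have Qt: "Q $ i $ j + Q $ j $ i = (if i = j then b $ i else 0)" for i j
    using sbp by (simp add: vec_eq_iff transpose_def diag_def)
  have row: "(\<Sum>j\<in>UNIV. Q $ i $ j) = 0" for i
    using Q1 by (simp add: vec_eq_iff matrix_vector_mult_def)
  have col: "(\<Sum>j\<in>UNIV. Q $ j $ i) = b $ i" for i
  proof -
    have "(\<Sum>j\<in>UNIV. Q $ i $ j + Q $ j $ i) = b $ i"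
      by (simp add: Qt)
    then show ?thesis by (simp add: sum.distrib row)
  qed
  have swap: "(\<Sum>i\<in>UNIV. \<Sum>j\<in>UNIV. Q $ j $ i * (V $ i \<bullet> G $ i $ j))
      = (\<Sum>i\<in>UNIV. \<Sum>j\<in>UNIV. Q $ i $ j * (V $ j \<bullet> G $ i $ j))"
    by (subst sum.swap) (simp add: sym)
  have "V \<bullet> hadamard_ones (2 *\<^sub>R Q) G = (\<Sum>i\<in>UNIV. \<Sum>j\<in>UNIV. 2 * Q $ i $ j * (V $ i \<bullet> G $ i $ j))"
    by (simp add: inner_vec_def[of V] hadamard_ones_def inner_sum_right)
  also have "\<dots> = (\<Sum>i\<in>UNIV. \<Sum>j\<in>UNIV. (Q $ i $ j - Q $ j $ i) * (V $ i \<bullet> G $ i $ j)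
       + (Q $ i $ j + Q $ j $ i) * (V $ i \<bullet> G $ i $ j))"
    by (simp add: algebra_simps)
  also have "\<dots> = (\<Sum>i\<in>UNIV. \<Sum>j\<in>UNIV. Q $ i $ j * ((V $ i - V $ j) \<bullet> G $ i $ j))
       + (\<Sum>i\<in>UNIV. b $ i * (V $ i \<bullet> G $ i $ i))"
    by (simp only: Qt sum.distrib left_diff_distrib inner_diff_left right_diff_distrib sum_subtractf swap)
       (simp add: if_distrib if_distribR cong: if_cong)
  also have "(\<Sum>i\<in>UNIV. \<Sum>j\<in>UNIV. Q $ i $ j * ((V $ i - V $ j) \<bullet> G $ i $ j))
      = (\<Sum>i\<in>UNIV. (\<Sum>j\<in>UNIV. Q $ i $ j) * \<psi> $ i) - (\<Sum>i\<in>UNIV. \<Sum>j\<in>UNIV. Q $ i $ j * \<psi> $ j)"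
    by (simp add: shuffle right_diff_distrib sum_subtractf sum_distrib_right)
  also have "(\<Sum>i\<in>UNIV. \<Sum>j\<in>UNIV. Q $ i $ j * \<psi> $ j) = (\<Sum>j\<in>UNIV. (\<Sum>i\<in>UNIV. Q $ i $ j) * \<psi> $ j)"
    by (subst sum.swap) (simp add: sum_distrib_right)
  finally show ?thesis
    by (simp add: row col sum_subtractf right_diff_distrib)
qed

section \<open>Entropy balance of one element\<close>

text \<open>
  The chain rule is needed for one-sided derivatives as well, since \<open>t\<close> may be an end point of
  the time interval \<open>I\<close>.
\<close>

lemma has_vector_derivative_pointwise:
  fixes w :: "real \<Rightarrow> real^'n^'q"
  assumes w: "(w has_vector_derivative w') (at t within I)"
    and grad: "\<And>a. GDERIV U (w t $ a) :> v (w t $ a)"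
  shows "((\<lambda>\<tau>. pointwise U (w \<tau>)) has_vector_derivative (\<chi> a. v (w t $ a) \<bullet> w' $ a)) (at t within I)"
proof -
  have "((\<lambda>\<tau>. U (w \<tau> $ a)) has_derivative (\<lambda>h. h * (v (w t $ a) \<bullet> w' $ a))) (at t within I)" for a
  proof -
    have "((\<lambda>\<tau>. w \<tau> $ a) has_derivative (\<lambda>h. (h *\<^sub>R w') $ a)) (at t within I)"
      using w unfolding has_vector_derivative_def
      by (rule bounded_linear.has_derivative[OF bounded_linear_vec_nth])
    from has_derivative_compose[OF this grad[of a, unfolded gderiv_def]]
    show ?thesis by (simp add: inner_commute)
  qed
  then show ?thesis
    unfolding has_vector_derivative_def
    by (subst has_derivative_componentwise_within)
       (auto simp: Basis_vec_def inner_axis pointwise_def)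
qed

lemma has_vector_derivative_matrix_mult:
  fixes V :: "real^'p^'q" and w :: "real \<Rightarrow> real^'n^'p"
  assumes "(w has_vector_derivative w') (at t within I)"
  shows "((\<lambda>\<tau>. V ** w \<tau>) has_vector_derivative V ** w') (at t within I)"
proof -
  have "linear (\<lambda>Y :: real^'n^'p. V ** Y)"
    by (rule linearI) (simp_all add: matrix_add_ldistrib matrix_scalar_ac flip: scalar_matrix_assoc)
  then show ?thesis
    using bounded_linear.has_vector_derivative[OF _ assms] linear_conv_bounded_linear by blast
qed

lemma diag_mult_hadamard_ones: "diag w ** hadamard_ones (2 *\<^sub>R D) G = hadamard_ones (2 *\<^sub>R (diag w ** D)) G"
  by (simp add: vec_eq_iff[where x = "_ ** _"] diag_mult_component hadamard_ones_def scaleR_sum_right mult_ac)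

lemma sum_UNIV_Plus:
  fixes g :: "'a::finite + 'b::finite \<Rightarrow> real"
  shows "(\<Sum>m\<in>UNIV. g m) = (\<Sum>i\<in>UNIV. g (Inl i)) + (\<Sum>i\<in>UNIV. g (Inr i))"
  using sum.Plus[of "UNIV :: 'a set" "UNIV :: 'b set" g] by (simp add: comp_def)

text \<open>
  Entropy changes on one element only through its surface.  The weight-adjusted inverse mass matrix
  \<open>M\<inverse> M\<^sub>1\<^sub>/\<^sub>J M\<inverse>\<close> is symmetric and also occurs in the projection of the entropy variables.  Hence
  testing the scheme with \<open>J v(u\<^sub>q)\<close> under volume quadrature is the same as testing its right-hand
  side, stripped of that matrix, with the projected entropy variables.  At the quadrature points
  these take the values for which the fluxes satisfy the entropy condition, so the volume term is
  covered by flux differencing.  It leaves \<open>v\<^sup>T f - \<psi>\<close> on the surface, where the interface correction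
  \<open>f\<^sup>* - f\<close> exchanges \<open>f\<close> for the numerical flux.
\<close>

lemma element_entropy_balance:
  fixes R :: "('d::finite, 'p::finite, 'q::finite, 's::finite, 'g::finite) ref_element"
    and X :: "('d, 'k::finite, 'q, 's) curved_mesh"
    and wq :: "real^'n^'q" and dw vh :: "real^'n^'p" and vt ut :: "real^'n^('q + 's)"
    and fstar :: "'d \<Rightarrow> real^'n^'s"
  assumes R: "reference_element R" and X: "mesh R X \<kappa>"
    and flux: "\<And>j. entropy_conservative_flux A v u (f j) (F j) (fS j)"
    and Q1: "\<And>j. Qk R X k j *v 1 = 0"
    and vh: "vh = Ptilde R X k ** pointwise v wq"
    and vt: "vt = vcat (Vq R) (Vf R) ** vh"
    and ut: "\<And>m. ut $ m \<in> A" "\<And>m. v (ut $ m) = vt $ m"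
    and scheme: "dw
           + matrix_inv (mass R) ** mass_invJ R X k ** matrix_inv (mass R)
               ** hcat (transpose (Vq R) ** Wq R) (transpose (Vf R) ** Wf R)
               ** (\<Sum>j\<in>UNIV. hadamard_ones (2 *\<^sub>R Dk R X k j) (\<chi> m n. fS j (ut $ m) (ut $ n)))
           + (\<Sum>j\<in>UNIV. Ltilde R X k ** diag (nsurf R X k j)
               ** (fstar j - pointwise (f j) (surf_part ut))) = 0"
  shows "1 \<bullet> (diag (Jvol R X k) ** Wq R *v (\<chi> a. v (wq $ a) \<bullet> (Vq R ** dw) $ a))
    = (\<Sum>j\<in>UNIV. \<Sum>s\<in>UNIV. surf_weight R $ s * (nsurf R X k j * Jsurf R X k) $ s
        * (potential u (f j) (F j) (vt $ Inr s) - vt $ Inr s \<bullet> fstar j $ s))"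
proof -
  interpret reference_element R by fact
  let ?M = "matrix_inv (mass R) ** mass_invJ R X k ** matrix_inv (mass R)"
  let ?G = "\<lambda>j. \<chi> m n. fS j (ut $ m) (ut $ n)"
  let ?S = "\<lambda>j. hadamard_ones (2 *\<^sub>R Dk R X k j) (?G j)"
  let ?d = "\<lambda>j. fstar j - pointwise (f j) (surf_part ut)"
  let ?H = "hcat (transpose (Vq R) ** Wq R) (transpose (Vf R) ** Wf R)"
  let ?T = "\<lambda>j. transpose (Vf R) ** Wf R ** diag (Jsurf R X k) ** diag (nsurf R X k j) ** ?d j"
  let ?nJ = "\<lambda>j. nsurf R X k j * Jsurf R X k"
  define z where "z = transpose (Vq R) ** Wq R ** diag (Jvol R X k) ** pointwise v wq"
  define b where "b = ?H ** (\<Sum>j\<in>UNIV. ?S j) + (\<Sum>j\<in>UNIV. ?T j)"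

  have M_sym: "transpose ?M = ?M"
    by (simp add: mass_invJ_def Wq_def matrix_transpose_mul transpose_mass_inv diag_mult_diag
        mult.commute flip: matrix_mul_assoc)
  have vh_eq: "vh = ?M ** z"
    by (simp add: vh z_def Ptilde_def matrix_mul_assoc)
  have dw: "dw = - (?M ** b)"
  proof -
    have "dw + ?M ** b = 0"
      using scheme by (simp add: b_def matrix_add_ldistrib matrix_sum_ldistrib Ltilde_def matrix_mul_assoc add.assoc)
    then show ?thesis by (simp add: eq_neg_iff_add_eq_0)
  qed

  have "1 \<bullet> (diag (Jvol R X k) ** Wq R *v (\<chi> a. v (wq $ a) \<bullet> (Vq R ** dw) $ a))
      = (diag (Jvol R X k) ** Wq R ** pointwise v wq) \<bullet> (Vq R ** dw)"
    by (simp add: Wq_def diag_mult_diag diag_mult_vector inner_vec_def[where 'b = 'q] diag_mult_component pointwise_def)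
  also have "\<dots> = z \<bullet> dw"
    by (simp add: inner_commute[of _ "Vq R ** dw"] inner_matrix_mult inner_commute[of dw] z_def Wq_def
        diag_mult_diag mult.commute matrix_mul_assoc)
       (simp add: diag_mult_diag mult.commute flip: matrix_mul_assoc)
  also have "\<dots> = - (vh \<bullet> b)"
    by (simp add: dw vh_eq inner_matrix_mult M_sym)
  finally have lhs: "1 \<bullet> (diag (Jvol R X k) ** Wq R *v (\<chi> a. v (wq $ a) \<bullet> (Vq R ** dw) $ a)) = - (vh \<bullet> b)" .

  have surf: "vt $ Inr s = (Vf R ** vh) $ s" for s
    by (simp add: vt matrix_matrix_mult_def vcat_def vec_eq_iff)
  have vol_term: "vh \<bullet> (?H ** (\<Sum>j\<in>UNIV. ?S j))
      = (\<Sum>j\<in>UNIV. \<Sum>s\<in>UNIV. surf_weight R $ s * ?nJ j $ s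
          * (vt $ Inr s \<bullet> f j (ut $ Inr s) - potential u (f j) (F j) (vt $ Inr s)))"
  proof -
    have "?H = transpose (vcat (Vq R) (Vf R)) ** WN R"
      by (simp add: Wq_def Wf_def hcat_transpose_diag WN_eq)
    then have "vh \<bullet> (?H ** (\<Sum>j\<in>UNIV. ?S j)) = (\<Sum>j\<in>UNIV. vt \<bullet> (WN R ** ?S j))"
      by (simp add: vt inner_matrix_mult matrix_mul_assoc matrix_sum_ldistrib inner_sum_right)
    also have "\<dots> = (\<Sum>j\<in>UNIV. vt \<bullet> hadamard_ones (2 *\<^sub>R Qk R X k j) (?G j))"
      by (simp add: WN_eq diag_mult_hadamard_ones Qk_def)
    also have "\<dots> = (\<Sum>j\<in>UNIV. \<Sum>m\<in>UNIV. vcat 0 (surf_weight R * ?nJ j) $ m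
          * (vt $ m \<bullet> ?G j $ m $ m - pointwise (potential u (f j) (F j)) vt $ m))"
    proof (rule sum.cong[OF refl], rule flux_differencing[OF Qk_sbp[OF R X] Q1])
      fix j m n
      show "?G j $ m $ n = ?G j $ n $ m"
        using flux[of j] ut(1) by (simp add: entropy_conservative_flux_def)
      have "(v (ut $ m) - v (ut $ n)) \<bullet> fS j (ut $ m) (ut $ n)
          = potential u (f j) (F j) (v (ut $ m)) - potential u (f j) (F j) (v (ut $ n))"
        using flux[of j] ut(1) unfolding entropy_conservative_flux_def by blast
      then show "(vt $ m - vt $ n) \<bullet> ?G j $ m $ n
          = pointwise (potential u (f j) (F j)) vt $ m - pointwise (potential u (f j) (F j)) vt $ n"
        by (simp add: ut(2) pointwise_def)
    qed
    also have "\<dots> = (\<Sum>j\<in>UNIV. \<Sum>s\<in>UNIV. surf_weight R $ s * ?nJ j $ s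
          * (vt $ Inr s \<bullet> f j (ut $ Inr s) - potential u (f j) (F j) (vt $ Inr s)))"
      using flux ut(1) by (simp add: sum_UNIV_Plus vcat_def pointwise_def entropy_conservative_flux_def)
    finally show ?thesis .
  qed
  have surf_term: "vh \<bullet> ?T j = (\<Sum>s\<in>UNIV. surf_weight R $ s * ?nJ j $ s
      * (vt $ Inr s \<bullet> fstar j $ s - vt $ Inr s \<bullet> f j (ut $ Inr s)))" for j
  proof -
    have "vh \<bullet> ?T j = (Vf R ** vh) \<bullet> (diag (surf_weight R * ?nJ j) ** ?d j)"
      by (simp add: inner_matrix_mult Wf_def diag_mult_diag mult_ac matrix_mul_assoc)
         (simp add: diag_mult_diag mult_ac flip: matrix_mul_assoc)
    then show ?thesis
      by (simp add: inner_vec_def[where 'b = 's] diag_mult_component surf inner_diff_right pointwise_def surf_part_def)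
  qed
  show ?thesis
    unfolding lhs b_def inner_add_right vol_term inner_sum_right surf_term
    by (simp add: sum.distrib[symmetric] sum_negf[symmetric] algebra_simps)
qed

section \<open>Cancellation across interior faces\<close>

lemma sum_involution_cancel:
  fixes T :: "'a \<Rightarrow> real"
  assumes "\<And>p. p \<in> S \<Longrightarrow> \<pi> p \<in> S" and "\<And>p. p \<in> S \<Longrightarrow> \<pi> (\<pi> p) = p"
    and "\<And>p. p \<in> S \<Longrightarrow> T (\<pi> p) = - T p"
  shows "sum T S = 0"
proof -
  have "sum T S = (\<Sum>p\<in>S. T (\<pi> p))"
    by (rule sum.reindex_bij_witness[of S \<pi> \<pi>]) (use assms in auto)
  also have "\<dots> = - sum T S"
    using assms(3) by (simp add: sum_negf)
  finally show ?thesis by simp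
qed

context mesh
begin

lemma neighbor_sym: "neighbor R X p p' \<Longrightarrow> neighbor R X p' p"
  by (cases p; cases p') (auto simp: neighbor_def shared_face_def interior_face_def)

text \<open>
  Watertightness determines the face on the other side, and the matching of quadrature points then
  determines the point on it.
\<close>

lemma ex1_neighbor:
  assumes "interior_face R X k (face_index R s)"
  shows "\<exists>!p. neighbor R X (k, s) p"
proof -
  obtain k' g' where sf: "shared_face R X (k, face_index R s) (k', g')"
      and uniq: "\<And>kg. shared_face R X (k, face_index R s) kg \<Longrightarrow> kg = (k', g')"
    using watertight[OF assms] by (metis surj_pair)
  obtain s' where s': "face_index R s' = g'"
        "elem_map X k (surf_point R s) = elem_map X k' (surf_point R s')"
        "\<And>r. face_index R r = g' \<Longrightarrow> elem_map X k (surf_point R s) = elem_map X k' (surf_point R r) \<Longrightarrow> r = s'"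
    using points_match[OF sf] by blast
  show ?thesis
  proof (rule ex1I[of _ "(k', s')"])
    show "neighbor R X (k, s) (k', s')"
      using sf s'(1,2) by (simp add: neighbor_def)
    fix p assume p: "neighbor R X (k, s) p"
    obtain l r where lr: "p = (l, r)" by (cases p)
    have "(l, face_index R r) = (k', g')"
      using p by (intro uniq) (simp add: neighbor_def lr)
    then show "p = (k', s')"
      using p s'(3)[of r] by (simp add: neighbor_def lr)
  qed
qed

text \<open>
  A point away from \<open>\<partial>\<Omega>\<close> lies on an interior face, so passing to the neighbor is an involution of
  these points.  An interior face may have points on \<open>\<partial>\<Omega>\<close>, for instance at its vertices; those
  belong to the boundary sum, so the cancellation is stated by position and not by face.
\<close>

lemma sum_off_boundary_cancel:
  fixes T :: "'k \<times> 's \<Rightarrow> real"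
  assumes R: "reference_element R"
    and anti: "\<And>p p'. neighbor R X p p' \<Longrightarrow> T p' = - T p"
  shows "sum T {(k, s). elem_map X k (surf_point R s) \<notin> frontier (domain X)} = 0"
proof -
  interpret reference_element R by fact
  let ?S = "{(k, s). elem_map X k (surf_point R s) \<notin> frontier (domain X)}"
  define \<pi> where "\<pi> p = (THE p'. neighbor R X p p')" for p
  have ex1: "\<exists>!p'. neighbor R X p p'" if "p \<in> ?S" for p
  proof -
    obtain k s where p: "p = (k, s)" by (cases p)
    have "interior_face R X k (face_index R s)"
      using that surf_point[of s] by (auto simp: p interior_face_def)
    then show ?thesis unfolding p by (rule ex1_neighbor)
  qed
  have nb: "neighbor R X p (\<pi> p)" if "p \<in> ?S" for p
    unfolding \<pi>_def by (rule theI'[OF ex1[OF that]])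
  have mem: "\<pi> p \<in> ?S" if "p \<in> ?S" for p
    using nb[OF that] that by (cases p; cases "\<pi> p") (auto simp: neighbor_def)
  show ?thesis
  proof (rule sum_involution_cancel[where \<pi> = \<pi>])
    show "\<pi> p \<in> ?S" if "p \<in> ?S" for p by (rule mem[OF that])
    show "\<pi> (\<pi> p) = p" if "p \<in> ?S" for p
      using ex1[OF mem[OF that]] nb[OF mem[OF that]] neighbor_sym[OF nb[OF that]] by blast
    show "T (\<pi> p) = - T p" if "p \<in> ?S" for p
      by (rule anti[OF nb[OF that]])
  qed
qed

lemma neighbor_normals:
  assumes "neighbor R X (k, s) (k', s')"
  shows "(nsurf R X k' j * Jsurf R X k') $ s' = - (nsurf R X k j * Jsurf R X k) $ s"
  using arg_cong[OF normals_match[OF assms], of "\<lambda>n. n $ j"] by (simp add: nsurf_def mult.commute)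

end

section \<open>Entropy conservation\<close>

theorem theorem2:
  fixes R :: "('d::finite, 'p::finite, 'q::finite, 's::finite, 'g::finite) ref_element"
    and X :: "('d, 'k::finite, 'q, 's) curved_mesh"
    and \<kappa> :: real
    and A :: "(real^'n) set"
    and U :: "real^'n \<Rightarrow> real"
    and v u :: "real^'n \<Rightarrow> real^'n"
    and f :: "'d \<Rightarrow> real^'n \<Rightarrow> real^'n"
    and F :: "'d \<Rightarrow> real^'n \<Rightarrow> real"
    and fS :: "'d \<Rightarrow> real^'n \<Rightarrow> real^'n \<Rightarrow> real^'n"
    and I :: "real set"
    and uh vh :: "'k \<Rightarrow> real \<Rightarrow> real^'n^'p"
    and uq :: "'k \<Rightarrow> real \<Rightarrow> real^'n^'q"
    and vt ut :: "'k \<Rightarrow> real \<Rightarrow> real^'n^('q + 's)"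
    and fstar :: "'k \<Rightarrow> real \<Rightarrow> 'd \<Rightarrow> real^'n^'s"
  assumes "reference_element R"
    and "mesh R X \<kappa>"
    and "entropy_system A U v u f F"
    and "\<And>j. entropy_conservative_flux A v u (f j) (F j) (fS j)"
    and "\<And>k j. Qk R X k j *v 1 = 0"
    and "is_interval I" and "interior I \<noteq> {}"
    and "\<And>k t. uq k t = Vq R ** uh k t"
    and "\<And>k t. vh k t = Ptilde R X k ** pointwise v (uq k t)"
    and "\<And>k t. vt k t = vcat (Vq R) (Vf R) ** vh k t"
    and "\<And>k t. ut k t = pointwise u (vt k t)"
    and "\<And>k t a. t \<in> I \<Longrightarrow> uq k t $ a \<in> A"
    and "\<And>k t m. t \<in> I \<Longrightarrow> vt k t $ m \<in> v ` A"
    and "\<And>k t j s k' s'. t \<in> I \<Longrightarrow> neighbor R X (k, s) (k', s') \<Longrightarrow>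
           fstar k t j $ s = fS j (surf_part (ut k' t) $ s') (surf_part (ut k t) $ s)"
    and "\<And>k t. t \<in> I \<Longrightarrow> uh k differentiable (at t within I)"
    and "\<And>k t. t \<in> I \<Longrightarrow>
           vector_derivative (uh k) (at t within I)
           + matrix_inv (mass R) ** mass_invJ R X k ** matrix_inv (mass R)
               ** hcat (transpose (Vq R) ** Wq R) (transpose (Vf R) ** Wf R)
               ** (\<Sum>j\<in>UNIV. hadamard_ones (2 *\<^sub>R Dk R X k j) (\<chi> m n. fS j (ut k t $ m) (ut k t $ n)))
           + (\<Sum>j\<in>UNIV. Ltilde R X k ** diag (nsurf R X k j)
               ** (fstar k t j - pointwise (f j) (surf_part (ut k t)))) = 0"
  shows "\<forall>t\<in>I. (\<forall>k. (\<lambda>\<tau>. pointwise U (uq k \<tau>)) differentiable (at t within I)) \<and>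
    (\<Sum>k\<in>UNIV. 1 \<bullet> (diag (Jvol R X k) ** Wq R
        *v vector_derivative (\<lambda>\<tau>. pointwise U (uq k \<tau>)) (at t within I))) =
    (\<Sum>k\<in>UNIV. \<Sum>j\<in>UNIV. 1 \<bullet> (diag (nsurf R X k j * Jsurf R X k) ** Wboundary R X k
        *v (pointwise (\<lambda>w. potential u (f j) (F j) (v w)) (surf_part (ut k t))
            - (\<chi> s. surf_part (vt k t) $ s \<bullet> fstar k t j $ s))))"
proof (intro ballI conjI allI)
  note R = assms(1) and X = assms(2) and flux = assms(4)
  interpret mesh R X \<kappa> by fact
  interpret entropy_system A U v u f F by fact
  fix t assume t: "t \<in> I"
  \<comment> \<open>On a single point the derivative would not be unique; an interval with interior points has no isolated ones.\<close>
  have limit: "at t within I \<noteq> bot"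
  proof -
    have "I \<noteq> {x}" for x
      using assms(7) by auto
    then have "t islimpt I"
      using connected_imp_perfect[of I t] is_interval_connected[OF assms(6)] t by blast
    then show ?thesis by (simp add: trivial_limit_within)
  qed
  \<comment> \<open>The entropy variables of the recovered states are the projected ones, as these lie in the range of \<open>v\<close>.\<close>
  have u_v: "ut k t $ m \<in> A \<and> v (ut k t $ m) = vt k t $ m" for k m
    using assms(13)[OF t, of k m] by (auto simp: assms(11) pointwise_def u_inverse)
  define dw where "dw k = vector_derivative (uh k) (at t within I)" for k
  have dU: "((\<lambda>\<tau>. pointwise U (uq k \<tau>)) has_vector_derivative
      (\<chi> a. v (uq k t $ a) \<bullet> (Vq R ** dw k) $ a)) (at t within I)" for k
  proof (rule has_vector_derivative_pointwise)
    show "(uq k has_vector_derivative Vq R ** dw k) (at t within I)"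
      using has_vector_derivative_matrix_mult[of "uh k" "dw k" t I "Vq R"] assms(15)[OF t, of k]
      by (simp add: assms(8)[abs_def] dw_def vector_derivative_works)
    show "GDERIV U (uq k t $ a) :> v (uq k t $ a)" for a
      by (rule entropy_variables[OF assms(12)[OF t]])
  qed
  show "(\<lambda>\<tau>. pointwise U (uq k \<tau>)) differentiable (at t within I)" for k
    using dU by (rule differentiableI_vector)

  \<comment> \<open>The contribution of one surface point to the entropy balance of its element.\<close>
  define T where "T j = (\<lambda>(k, s). surf_weight R $ s * (nsurf R X k j * Jsurf R X k) $ s
      * (potential u (f j) (F j) (vt k t $ Inr s) - vt k t $ Inr s \<bullet> fstar k t j $ s))" for j
  let ?on = "\<lambda>(k, s). elem_map X k (surf_point R s) \<in> frontier (domain X)"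
  \<comment> \<open>Across a face the flux and the weight agree and the normals are opposite.  By the entropy
    condition \<open>\<psi> - v\<^sup>T f\<^sup>*\<close> takes the same value on both sides.\<close>
  have anti: "T j p' = - T j p" if "neighbor R X p p'" for j p p'
  proof -
    obtain k s k' s' where p: "p = (k, s)" "p' = (k', s')" by (cases p; cases p')
    have nb: "neighbor R X (k, s) (k', s')" using that p by simp
    have fl: "fstar k t j $ s = fS j (ut k' t $ Inr s') (ut k t $ Inr s)"
        "fstar k' t j $ s' = fS j (ut k' t $ Inr s') (ut k t $ Inr s)"
      using assms(14)[OF t nb] assms(14)[OF t neighbor_sym[OF nb]] flux[of j] u_v
      by (simp_all add: surf_part_def entropy_conservative_flux_def)
    have "(vt k' t $ Inr s' - vt k t $ Inr s) \<bullet> fS j (ut k' t $ Inr s') (ut k t $ Inr s)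
        = potential u (f j) (F j) (vt k' t $ Inr s') - potential u (f j) (F j) (vt k t $ Inr s)"
      (is "(_ - _) \<bullet> ?g = _")
      using flux[of j] u_v unfolding entropy_conservative_flux_def by metis
    then have potentials: "potential u (f j) (F j) (vt k' t $ Inr s') - vt k' t $ Inr s' \<bullet> ?g
        = potential u (f j) (F j) (vt k t $ Inr s) - vt k t $ Inr s \<bullet> ?g"
      by (simp add: inner_diff_left)
    show ?thesis
      unfolding T_def p prod.case fl potentials weights_match[OF nb] neighbor_normals[OF nb] by simp
  qed
  have points: "(\<Sum>k\<in>UNIV. \<Sum>j\<in>UNIV. \<Sum>s\<in>UNIV. g j (k, s)) = (\<Sum>j\<in>UNIV. \<Sum>p\<in>UNIV. g j p)"
    for g :: "'d \<Rightarrow> 'k \<times> 's \<Rightarrow> real"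
    by (subst sum.swap) (simp add: sum.cartesian_product)
  have "(\<Sum>k\<in>UNIV. 1 \<bullet> (diag (Jvol R X k) ** Wq R
        *v vector_derivative (\<lambda>\<tau>. pointwise U (uq k \<tau>)) (at t within I)))
      = (\<Sum>k\<in>UNIV. \<Sum>j\<in>UNIV. \<Sum>s\<in>UNIV. T j (k, s))"
  proof (rule sum.cong[OF refl])
    fix k
    show "1 \<bullet> (diag (Jvol R X k) ** Wq R
        *v vector_derivative (\<lambda>\<tau>. pointwise U (uq k \<tau>)) (at t within I)) = (\<Sum>j\<in>UNIV. \<Sum>s\<in>UNIV. T j (k, s))"
      unfolding vector_derivative_within[OF limit dU] T_def prod.case
      by (rule element_entropy_balance[OF R X flux assms(5,9,10) _ _ assms(16)[OF t, folded dw_def]])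
         (use u_v in auto)
  qed
  also have "\<dots> = (\<Sum>j\<in>UNIV. \<Sum>p\<in>UNIV. T j p)"
    by (rule points)
  also have "\<dots> = (\<Sum>j\<in>UNIV. \<Sum>p\<in>UNIV. if ?on p then T j p else 0)"
  proof (rule sum.cong[OF refl])
    fix j
    have "(\<Sum>p\<in>UNIV. if ?on p then 0 else T j p) = sum (T j) {p. \<not> ?on p}"
      by (simp add: sum.If_cases Collect_neg_eq)
    also have "{p. \<not> ?on p} = {(k, s). elem_map X k (surf_point R s) \<notin> frontier (domain X)}"
      by auto
    also have "sum (T j) \<dots> = 0"
      by (rule sum_off_boundary_cancel[OF R anti])
    finally have off: "(\<Sum>p\<in>UNIV. if ?on p then 0 else T j p) = 0" .
    have "(\<Sum>p\<in>UNIV. T j p) = (\<Sum>p\<in>UNIV. (if ?on p then T j p else 0) + (if ?on p then 0 else T j p))"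
      by (intro sum.cong refl) simp
    then show "(\<Sum>p\<in>UNIV. T j p) = (\<Sum>p\<in>UNIV. if ?on p then T j p else 0)"
      by (simp only: sum.distrib off add_0_right)
  qed
  also have "\<dots> = (\<Sum>k\<in>UNIV. \<Sum>j\<in>UNIV. \<Sum>s\<in>UNIV. if ?on (k, s) then T j (k, s) else 0)"
    by (rule points[symmetric])
  also have "\<dots> = (\<Sum>k\<in>UNIV. \<Sum>j\<in>UNIV. 1 \<bullet> (diag (nsurf R X k j * Jsurf R X k) ** Wboundary R X k
        *v (pointwise (\<lambda>w. potential u (f j) (F j) (v w)) (surf_part (ut k t))
            - (\<chi> s. surf_part (vt k t) $ s \<bullet> fstar k t j $ s))))"
    using u_v
    by (intro sum.cong refl)
       (auto simp: T_def Wboundary_def diag_mult_diag diag_mult_vector inner_vec_def[where 'b = 's] pointwise_def surf_part_def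
          intro!: sum.cong)
  finally show "(\<Sum>k\<in>UNIV. 1 \<bullet> (diag (Jvol R X k) ** Wq R
        *v vector_derivative (\<lambda>\<tau>. pointwise U (uq k \<tau>)) (at t within I))) =
    (\<Sum>k\<in>UNIV. \<Sum>j\<in>UNIV. 1 \<bullet> (diag (nsurf R X k j * Jsurf R X k) ** Wboundary R X k
        *v (pointwise (\<lambda>w. potential u (f j) (F j) (v w)) (surf_part (ut k t))
            - (\<chi> s. surf_part (vt k t) $ s \<bullet> fstar k t j $ s))))" .
qed

end
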